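(* Let $\ell>0$ be an integer and let $\mathcal{T}=(Q,\Sigma,\delta)$ be the $G$-automaton with alphabet $\Sigma=\{0,1,\square\}$ (three distinct letters), state set $Q=\{p,q_1,\dots,q_\ell,\mathrm{id}\}$ (so $|Q|=\ell+2$) and the following transitions, where $(s,a,b,t)$ denotes a transition from $s$ to $t$ with input $a$ and output $b$: - $(p,0,0,p)$, $(p,1,1,p)$, $(p,\square,\square,q_1)$; - $(q_i,0,0,q_i)$, $(q_i,1,1,q_i)$, $(q_i,\square,\square,q_{i+1})$ for $1\le i<\ell$; - $(q_\ell,1,0,p)$, $(q_\ell,0,1,\mathrm{id})$, $(q_\ell,\square,\square,q_\ell)$; - $(\mathrm{id},a,a,\mathrm{id})$ for all $a\in\Sigma$. Then, for every $m\ge1$, the word $(\square^\ell 0)^m$ is only expandable by words $x\in\Sigma^*$ of length $|x|\ge\ell+1=|Q|-1$ (that is, whenever $(\square^\ell0)^m$ is expandable by $x$, then $|x|\ge\ell+1$).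
   Context: $\Sigma^*$ is the set of finite words over $\Sigma$, including the empty word $\varepsilon$; $|x|$ is the length of $x$. Each state $q\in Q$ induces a length-preserving function $q\circ\colon\Sigma^*\to\Sigma^*$ mapping $u$ to the output of the unique run of the automaton starting in $q$ with input $u$. For $\boldsymbol q=s_r\dots s_1\in Q^*$, $\boldsymbol q\circ$ is the composition applying $s_1\circ$ first and $s_r\circ$ last; $\varepsilon\circ$ is the identity. The orbit of $u$ is $Q^*\circ u=\{\boldsymbol q\circ u\mid\boldsymbol q\in Q^*\}$. A word $u$ is expandable by $x$ (with respect to $\mathcal{T}$) if $|Q^*\circ ux|>|Q^*\circ u|$. A $G$-automaton is an automaton in which for every state $s$ and letter $a$ there is exactly one transition $(s,a,b,t)$, and for every state $s$ and letter $b$ at most one transition $(s,a,b,t)$. *)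

theory Defs
  imports Main
begin

record ('q, 'a) automaton =
  states :: "'q set"
  alphabet :: "'a set"
  transitions :: "('q \<times> 'a \<times> 'a \<times> 'q) set"

definition is_G_automaton :: "('q, 'a) automaton \<Rightarrow> bool" where
  "is_G_automaton T \<longleftrightarrow>
     finite (states T) \<and> finite (alphabet T) \<and>
     transitions T \<subseteq> states T \<times> alphabet T \<times> alphabet T \<times> states T \<and>
     (\<forall>s\<in>states T. \<forall>a\<in>alphabet T. \<exists>!(b, t). (s, a, b, t) \<in> transitions T) \<and>
     (\<forall>s\<in>states T. \<forall>b\<in>alphabet T. \<exists>\<^sub>\<le>\<^sub>1(a, t). (s, a, b, t) \<in> transitions T)"

inductive run :: "('q, 'a) automaton \<Rightarrow> 'q \<Rightarrow> 'a list \<Rightarrow> 'a list \<Rightarrow> 'q \<Rightarrow> bool"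
  for T where
  run_Nil: "s \<in> states T \<Longrightarrow> run T s [] [] s"
| run_Cons: "(s, a, b, t) \<in> transitions T \<Longrightarrow> run T t u v t' \<Longrightarrow> run T s (a # u) (b # v) t'"

definition act :: "('q, 'a) automaton \<Rightarrow> 'q \<Rightarrow> 'a list \<Rightarrow> 'a list" where
  "act T q u = (THE v. \<exists>t. run T q u v t)"

text \<open>A state sequence \<open>s\<^sub>r \<dots> s\<^sub>1\<close> is the list \<open>[s\<^sub>r, \<dots>, s\<^sub>1]\<close>; \<open>foldr\<close> applies its
  last element \<open>s\<^sub>1\<close> first.\<close>

definition act_seq :: "('q, 'a) automaton \<Rightarrow> 'q list \<Rightarrow> 'a list \<Rightarrow> 'a list" where
  "act_seq T qs u = foldr (act T) qs u"

definition orbit :: "('q, 'a) automaton \<Rightarrow> 'a list \<Rightarrow> 'a list set" where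
  "orbit T u = {act_seq T qs u | qs. qs \<in> lists (states T)}"

definition expandable :: "('q, 'a) automaton \<Rightarrow> 'a list \<Rightarrow> 'a list \<Rightarrow> bool" where
  "expandable T u x \<longleftrightarrow> card (orbit T (u @ x)) > card (orbit T u)"

text \<open>The unique description in \<^const>\<open>act\<close> is well defined, and orbits are finite, so that
  comparing them by \<^const>\<open>card\<close> is meaningful.\<close>

lemma run_ex1:
  assumes G: "is_G_automaton T" and "q \<in> states T" and "u \<in> lists (alphabet T)"
  shows "\<exists>!v. \<exists>t. run T q u v t"
  using assms(3,2)
proof (induction u arbitrary: q rule: lists.induct)
  case Nil
  then show ?case by (auto intro: run_Nil elim: run.cases)
next
  case (Cons a u)
  from G Cons.hyps Cons.prems obtain b t where bt: "(q, a, b, t) \<in> transitions T"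
    and uniq: "\<And>b' t'. (q, a, b', t') \<in> transitions T \<Longrightarrow> b' = b \<and> t' = t"
    unfolding is_G_automaton_def by (metis (no_types, lifting) case_prodE case_prodI prod.inject)
  from bt G have "t \<in> states T" by (auto simp: is_G_automaton_def)
  then obtain v t' where v: "run T t u v t'"
    and v_uniq: "\<And>w t''. run T t u w t'' \<Longrightarrow> w = v"
    using Cons.IH by blast
  show ?case
  proof (rule ex1I[of _ "b # v"])
    show "\<exists>t. run T q (a # u) (b # v) t" using run_Cons[OF bt v] by blast
  next
    fix w assume "\<exists>t. run T q (a # u) w t"
    then obtain t0 where "run T q (a # u) w t0" by blast
    then show "w = b # v"
    proof cases
      case (run_Cons b' t'' w')
      then show ?thesis using uniq v_uniq by blast
    qed
  qed
qed

lemma act_run: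
  assumes "is_G_automaton T" "q \<in> states T" "u \<in> lists (alphabet T)"
  shows "\<exists>t. run T q u (act T q u) t"
  unfolding act_def by (rule theI'[OF run_ex1[OF assms]])

lemma run_output:
  assumes "is_G_automaton T" "run T q u v t"
  shows "length v = length u \<and> v \<in> lists (alphabet T)"
  using assms(2,1) by (induction rule: run.induct) (auto simp: is_G_automaton_def)

lemma finite_orbit:
  assumes G: "is_G_automaton T" and u: "u \<in> lists (alphabet T)"
  shows "finite (orbit T u)"
proof -
  have "length (act_seq T qs u) = length u \<and> act_seq T qs u \<in> lists (alphabet T)"
    if "qs \<in> lists (states T)" for qs
    using that
  proof (induction qs)
    case Nil
    then show ?case using u by (simp add: act_seq_def)
  next
    case (Cons q qs)
    then have IH: "length (act_seq T qs u) = length u" "act_seq T qs u \<in> lists (alphabet T)"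
      and q: "q \<in> states T" by simp_all
    from act_run[OF G q IH(2)] run_output[OF G] IH(1) show ?case
      by (fastforce simp: act_seq_def)
  qed
  then have "orbit T u \<subseteq> {v. set v \<subseteq> alphabet T \<and> length v = length u}"
    by (fastforce simp: orbit_def)
  moreover have "finite (alphabet T)" using G by (simp add: is_G_automaton_def)
  ultimately show ?thesis by (rule finite_subset[OF _ finite_lists_length_eq])
qed

datatype letter = Zero | One | Box

text \<open>The states \<open>q\<^sub>1, \<dots>, q\<^sub>\<ell>\<close> are \<open>St_q 1, \<dots>, St_q \<ell>\<close>.\<close>

datatype state = St_p | St_q nat | St_id

definition counter :: "nat \<Rightarrow> (state, letter) automaton" where
  "counter l = \<lparr>
     states = {St_p, St_id} \<union> St_q ` {1..l},
     alphabet = {Zero, One, Box},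
     transitions =
       {(St_p, Zero, Zero, St_p), (St_p, One, One, St_p), (St_p, Box, Box, St_q 1)}
       \<union> (\<Union>i\<in>{1..<l}. {(St_q i, Zero, Zero, St_q i), (St_q i, One, One, St_q i),
                         (St_q i, Box, Box, St_q (i + 1))})
       \<union> {(St_q l, One, Zero, St_p), (St_q l, Zero, One, St_id), (St_q l, Box, Box, St_q l)}
       \<union> {(St_id, a, a, St_id) | a. a \<in> {Zero, One, Box}}\<rparr>"

lemma card_states_counter: "card (states (counter l)) = l + 2"
proof -
  have "{St_p, St_id} \<inter> St_q ` {1..l} = {}" by auto
  then have "card ({St_p, St_id} \<union> St_q ` {1..l}) = 2 + l"
    by (subst card_Un_disjoint) (auto simp: card_image inj_on_def)
  then show ?thesis by (simp add: counter_def)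
qed

lemma counter_G_automaton:
  assumes l: "l > 0"
  shows "is_G_automaton (counter l)"
proof -
  have fin: "finite (states (counter l))" "finite (alphabet (counter l))"
    by (simp_all add: counter_def)
  have letters: "c \<in> alphabet (counter l)" for c
    by (cases c) (simp_all add: counter_def)
  have St_q_mem: "St_q i \<in> states (counter l) \<longleftrightarrow> 1 \<le> i \<and> i \<le> l" for i
    by (auto simp: counter_def)
  have St_mem: "St_p \<in> states (counter l)" "St_id \<in> states (counter l)"
    by (simp_all add: counter_def)
  have "s \<in> states (counter l) \<and> t \<in> states (counter l)"
    if "(s, a, b, t) \<in> transitions (counter l)" for s a b t
  proof -
    have "s \<in> {St_p, St_id, St_q l} \<union> St_q ` {1..<l} \<and>
          t \<in> {St_p, St_id, St_q 1, St_q l} \<union> (\<Union>i\<in>{1..<l}. {St_q i, St_q (i + 1)})"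
      using that unfolding counter_def by auto
    then show ?thesis using l by (auto simp: St_q_mem St_mem simp del: One_nat_def)
  qed
  then have sub: "transitions (counter l) \<subseteq>
      states (counter l) \<times> alphabet (counter l) \<times> alphabet (counter l) \<times> states (counter l)"
    using letters by (intro subrelI) auto
  have ex: "\<exists>b t. (s, a, b, t) \<in> transitions (counter l)" if "s \<in> states (counter l)" for s a
  proof (cases s)
    case (St_q i)
    then have "i = l \<or> i \<in> {1..<l}" using that by (auto simp: counter_def)
    then show ?thesis
    proof
      assume "i = l"
      then show ?thesis by (cases a) (auto simp: counter_def St_q)
    next
      assume i: "i \<in> {1..<l}"
      have "(St_q i, a, a, if a = Box then St_q (i + 1) else St_q i) \<in> transitions (counter l)"
        unfolding counter_def automaton.select_convs
        by (rule UnI1, rule UnI1, rule UnI2, rule UN_I[OF i]) (cases a; simp)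
      then show ?thesis unfolding St_q by blast
    qed
  qed (cases a; auto simp: counter_def)+
  have out: "b = (if s = St_q l then case a of Zero \<Rightarrow> One | One \<Rightarrow> Zero | Box \<Rightarrow> Box else a)"
    if "(s, a, b, t) \<in> transitions (counter l)" for s a b t
    using that by (auto simp: counter_def)
  have tgt: "t = (case s of
      St_p \<Rightarrow> if a = Box then St_q 1 else St_p
    | St_q i \<Rightarrow> if i = l then case a of Zero \<Rightarrow> St_id | One \<Rightarrow> St_p | Box \<Rightarrow> St_q l
               else if a = Box then St_q (i + 1) else St_q i
    | St_id \<Rightarrow> St_id)"
    if "(s, a, b, t) \<in> transitions (counter l)" for s a b t
    using that by (auto simp: counter_def)
  have det: "b = b' \<and> t = t'"
    if "(s, a, b, t) \<in> transitions (counter l)" "(s, a, b', t') \<in> transitions (counter l)"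
    for s a b t b' t'
    using out[OF that(1)] out[OF that(2)] tgt[OF that(1)] tgt[OF that(2)] by simp
  have inv: "a = a' \<and> t = t'"
    if "(s, a, b, t) \<in> transitions (counter l)" "(s, a', b, t') \<in> transitions (counter l)"
    for s a b t a' t'
  proof -
    have "a = a'"
      using out[OF that(1)] out[OF that(2)] by (auto split: if_splits letter.splits)
    then show ?thesis using tgt[OF that(1)] tgt[OF that(2)] by (simp only: simp_thms)
  qed
  have "\<exists>!(b, t). (s, a, b, t) \<in> transitions (counter l)" if "s \<in> states (counter l)" for s a
    using ex[OF that] det by (auto)
  moreover have "\<exists>\<^sub>\<le>\<^sub>1(a, t). (s, a, b, t) \<in> transitions (counter l)" for s b
    using inv by (auto simp: Uniq_def)
  ultimately show ?thesis
    using fin sub by (simp add: is_G_automaton_def)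
qed

end

theory Submission
  imports Defs
begin

text \<open>On a word \<open>\<box>\<^sup>\<ell> d\<^sub>1 \<dots> \<box>\<^sup>\<ell> d\<^sub>m\<close> with binary digits \<open>d\<^sub>i\<close>, every state other than \<open>id\<close> is driven
  to \<open>q\<^sub>\<ell>\<close> by the boxes, so it acts on the digits as the binary increment and ends in \<open>p\<close> or
  \<open>id\<close>. Neither of these changes a word \<open>x\<close> with \<open>|x| \<le> \<ell>\<close>, because \<open>p\<close> has to read \<open>\<ell>\<close> boxes
  before it can change a digit. Hence appending such an \<open>x\<close> maps the orbit of
  \<open>(\<box>\<^sup>\<ell> 0)\<^sup>m\<close> bijectively onto the orbit of \<open>(\<box>\<^sup>\<ell> 0)\<^sup>m x\<close>.\<close>

lemma run_append:
  "run T s u v t \<Longrightarrow> run T t u' v' t' \<Longrightarrow> run T s (u @ u') (v @ v') t'"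
  by (induction rule: run.induct) (simp_all add: run_Cons)

lemma act_eqI:
  assumes "is_G_automaton T" "q \<in> states T" "u \<in> lists (alphabet T)" "run T q u v t"
  shows "act T q u = v"
  using act_run[OF assms(1-3)] run_ex1[OF assms(1-3)] assms(4) by blast

text \<open>\<open>U\<close> is an invariant containing the orbit of \<open>u\<close>. A single
  state has to leave \<open>x\<close> alone only behind words of \<open>U\<close>; closure under
  \<open>act\<close> carries this through every state sequence by induction.\<close>

lemma orbit_append:
  assumes u: "u \<in> U"
    and closed: "\<And>s v. s \<in> states T \<Longrightarrow> v \<in> U \<Longrightarrow> act T s v \<in> U"
    and fix_x: "\<And>s v. s \<in> states T \<Longrightarrow> v \<in> U \<Longrightarrow> act T s (v @ x) = act T s v @ x"
  shows "orbit T (u @ x) = (\<lambda>v. v @ x) ` orbit T u"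
proof -
  have "act_seq T qs u \<in> U \<and> act_seq T qs (u @ x) = act_seq T qs u @ x"
    if "qs \<in> lists (states T)" for qs
    using that by (induction qs) (auto simp: act_seq_def u closed fix_x)
  then show ?thesis by (auto simp: orbit_def) (metis in_listsI)
qed

text \<open>Appending a fixed word is injective, so both orbits have the same cardinality.\<close>

lemma not_expandable_if_orbit_append:
  assumes "orbit T (u @ x) = (\<lambda>v. v @ x) ` orbit T u"
  shows "\<not> expandable T u x"
  by (simp add: expandable_def assms card_image inj_on_def)

lemma counter_states [simp]:
  "St_p \<in> states (counter l)" "St_id \<in> states (counter l)"
  "St_q i \<in> states (counter l) \<longleftrightarrow> 1 \<le> i \<and> i \<le> l"
  by (auto simp: counter_def)

lemma lists_alphabet_counter [simp]: "u \<in> lists (alphabet (counter l))"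
proof -
  have "c \<in> alphabet (counter l)" for c by (cases c) (simp_all add: counter_def)
  then show ?thesis by auto
qed

lemma counter_transitions:
  "(St_p, a, a, if a = Box then St_q 1 else St_p) \<in> transitions (counter l)"
  "1 \<le> i \<Longrightarrow> i < l \<Longrightarrow>
    (St_q i, a, a, if a = Box then St_q (Suc i) else St_q i) \<in> transitions (counter l)"
  "(St_q l, One, Zero, St_p) \<in> transitions (counter l)"
  "(St_q l, Zero, One, St_id) \<in> transitions (counter l)"
  "(St_q l, Box, Box, St_q l) \<in> transitions (counter l)"
  "(St_id, a, a, St_id) \<in> transitions (counter l)"
proof -
  show "(St_q i, a, a, if a = Box then St_q (Suc i) else St_q i) \<in> transitions (counter l)"
    if i: "1 \<le> i" "i < l"
  proof -
    have mem: "i \<in> {1..<l}" using i by simp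
    show ?thesis
      unfolding counter_def automaton.select_convs
      by (rule UnI2[THEN UnI1, THEN UnI1], rule UN_I[OF mem]) (cases a; simp)
  qed
qed (cases a; simp add: counter_def)+

lemma run_id: "run (counter l) St_id x x St_id"
  by (induction x) (simp_all add: run_Nil run_Cons[OF counter_transitions(6)])

text \<open>Each letter raises the index by at most one, so \<open>St_q l\<close>, the only state
  that alters letters, is reached no earlier than after the last letter of \<open>x\<close>.\<close>

lemma run_q_short:
  "1 \<le> i \<Longrightarrow> i + length x \<le> l \<Longrightarrow> \<exists>t. run (counter l) (St_q i) x x t"
proof (induction x arbitrary: i)
  case Nil
  then have "run (counter l) (St_q i) [] [] (St_q i)" by (intro run_Nil) simp
  then show ?case by blast
next
  case (Cons a x)
  then have "\<exists>t. run (counter l) (if a = Box then St_q (Suc i) else St_q i) x x t" by auto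
  then show ?case using Cons.prems run_Cons[OF counter_transitions(2)[of i l a]] by fastforce
qed

text \<open>The bound is \<open>l\<close> and not \<open>l - 1\<close>: the first box is spent on
  entering \<open>St_q 1\<close>, which leaves at most \<open>l - 1\<close> letters for
  \<open>run_q_short\<close>.\<close>

lemma run_p_short:
  "length x \<le> l \<Longrightarrow> \<exists>t. run (counter l) St_p x x t"
proof (induction x)
  case Nil
  have "run (counter l) St_p [] [] St_p" by (intro run_Nil) simp
  then show ?case by blast
next
  case (Cons a x)
  then have "\<exists>t. run (counter l) (if a = Box then St_q 1 else St_p) x x t"
    using run_q_short[of 1 x l] by auto
  then show ?case using run_Cons[OF counter_transitions(1)] by blast
qed

text \<open>The minimum reflects the loop at \<open>St_q l\<close>, which absorbs all surplus
  boxes.\<close>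

lemma run_q_boxes:
  "1 \<le> i \<Longrightarrow> i \<le> l \<Longrightarrow>
    run (counter l) (St_q i) (replicate n Box) (replicate n Box) (St_q (min l (i + n)))"
proof (induction n arbitrary: i)
  case 0
  then show ?case by (auto intro: run_Nil simp: min_def)
next
  case (Suc n)
  show ?case
  proof (cases "i = l")
    case True
    then show ?thesis
      using Suc.IH[of l] Suc.prems by (simp add: run_Cons[OF counter_transitions(5)])
  next
    case False
    then have "(St_q i, Box, Box, St_q (Suc i)) \<in> transitions (counter l)"
      using counter_transitions(2)[of i l Box] Suc.prems by simp
    then show ?thesis
      using Suc.IH[of "Suc i"] Suc.prems False by (simp add: run_Cons)
  qed
qed

lemma run_boxes:
  assumes l: "l > 0" and s: "s \<in> states (counter l)" "s \<noteq> St_id"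
  shows "run (counter l) s (replicate l Box) (replicate l Box) (St_q l)"
proof (cases s)
  case St_p
  \<comment> \<open>One box leads to \<open>St_q 1\<close>; the other \<open>k\<close> boxes raise
    the index from 1 to exactly \<open>l\<close>.\<close>
  obtain k where k: "l = Suc k" using l by (cases l) auto
  have "run (counter l) (St_q 1) (replicate k Box) (replicate k Box) (St_q l)"
    using run_q_boxes[of 1 l k] k by simp
  then have "run (counter l) St_p (Box # replicate k Box) (Box # replicate k Box) (St_q l)"
    using run_Cons counter_transitions(1)[of Box l] by fastforce
  then show ?thesis by (simp add: k St_p)
next
  case (St_q i)
  then show ?thesis using run_q_boxes[of i l l] s by (simp add: min_def)
qed (use s in simp)

text \<open>For binary \<open>ds\<close> this encodes a counter value, least significant digit
  first: \<open>St_q l\<close> turns 1 into 0 and carries on in \<open>St_p\<close>, or turns 0 into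
  1 and stops in \<open>St_id\<close>.\<close>

definition blocks :: "nat \<Rightarrow> letter list \<Rightarrow> letter list" where
  "blocks l ds = concat (map (\<lambda>d. replicate l Box @ [d]) ds)"

lemma run_block:
  assumes "l > 0" "s \<in> states (counter l)" "d \<in> {Zero, One}"
  obtains d' t where "d' \<in> {Zero, One}" "t \<in> {St_p, St_id}"
    "run (counter l) s (replicate l Box @ [d]) (replicate l Box @ [d']) t"
proof (cases "s = St_id")
  case True
  then show ?thesis using that run_id assms(3) by blast
next
  case False
  have "\<exists>d' t. d' \<in> {Zero, One} \<and> t \<in> {St_p, St_id} \<and> (St_q l, d, d', t) \<in> transitions (counter l)"
    using assms(3) counter_transitions(3,4) by blast
  then obtain d' t where d': "d' \<in> {Zero, One}" "t \<in> {St_p, St_id}"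
    and tr: "(St_q l, d, d', t) \<in> transitions (counter l)" by blast
  have "t \<in> states (counter l)" using d'(2) by auto
  then have "run (counter l) (St_q l) [d] [d'] t" by (intro run_Cons[OF tr] run_Nil)
  then show ?thesis using that[OF d'] run_append[OF run_boxes[OF assms(1,2) False]] by simp
qed

text \<open>At least one digit must be read: on the empty word the run would end where it starts,
  possibly in some \<open>St_q i\<close>, and each of these alters some word of length at most
  \<open>l\<close>.\<close>

lemma run_blocks:
  assumes l: "l > 0"
  shows "ds \<noteq> [] \<Longrightarrow> ds \<in> lists {Zero, One} \<Longrightarrow> s \<in> states (counter l) \<Longrightarrow>
    \<exists>ds' t. ds' \<in> lists {Zero, One} \<and> ds' \<noteq> [] \<and> t \<in> {St_p, St_id} \<and>
      run (counter l) s (blocks l ds) (blocks l ds') t"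
proof (induction ds arbitrary: s rule: list_nonempty_induct)
  case (single d)
  then obtain d' t where "d' \<in> {Zero, One}" "t \<in> {St_p, St_id}"
    "run (counter l) s (replicate l Box @ [d]) (replicate l Box @ [d']) t"
    using run_block[OF l, of s d] by auto
  then show ?case by (intro exI[of _ "[d']"] exI[of _ t]) (auto simp: blocks_def)
next
  case (cons d ds)
  then have "d \<in> {Zero, One}" by simp
  with cons.prems(2) obtain d' t where d': "d' \<in> {Zero, One}" "t \<in> {St_p, St_id}"
    and r: "run (counter l) s (replicate l Box @ [d]) (replicate l Box @ [d']) t"
    using run_block[OF l] by blast
  have "t \<in> states (counter l)" using d'(2) by auto
  moreover have "ds \<in> lists {Zero, One}" using cons.prems(1) by simp
  ultimately obtain ds' t' where ds': "ds' \<in> lists {Zero, One}" "t' \<in> {St_p, St_id}"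
    and r': "run (counter l) t (blocks l ds) (blocks l ds') t'"
    using cons.IH by blast
  show ?case
    using d' ds' run_append[OF r r']
    by (intro exI[of _ "d' # ds'"] exI[of _ t']) (auto simp: blocks_def)
qed

text \<open>The digits \<open>ds'\<close> are fixed before \<open>x\<close>, so the outputs for all
  short \<open>x\<close>, including the empty word, share the same prefix.\<close>

lemma act_blocks:
  assumes l: "l > 0" and ds: "ds \<noteq> []" "ds \<in> lists {Zero, One}" and s: "s \<in> states (counter l)"
  obtains ds' where "ds' \<noteq> []" "ds' \<in> lists {Zero, One}"
    "\<And>x. length x \<le> l \<Longrightarrow> act (counter l) s (blocks l ds @ x) = blocks l ds' @ x"
proof -
  obtain ds' t where ds': "ds' \<in> lists {Zero, One}" "ds' \<noteq> []" and t: "t \<in> {St_p, St_id}"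
    and r: "run (counter l) s (blocks l ds) (blocks l ds') t"
    using run_blocks[OF l ds s] by blast
  have "act (counter l) s (blocks l ds @ x) = blocks l ds' @ x" if x: "length x \<le> l" for x
  proof -
    obtain t' where "run (counter l) t x x t'"
      using t run_id run_p_short[OF x] by blast
    then show ?thesis
      using act_eqI[OF counter_G_automaton[OF l] s lists_alphabet_counter run_append[OF r]] by blast
  qed
  then show ?thesis using that ds' by blast
qed

theorem proposition6p1:
  fixes l m :: nat
  assumes "l > 0" and "m \<ge> 1"
  shows "l + 1 = card (states (counter l)) - 1 \<and>
    (\<forall>x \<in> lists (alphabet (counter l)).
       expandable (counter l) (concat (replicate m (replicate l Box @ [Zero]))) x
       \<longrightarrow> length x \<ge> l + 1)"
proof (intro conjI ballI impI)
  show "l + 1 = card (states (counter l)) - 1" by (simp add: card_states_counter)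
next
  fix x
  let ?u = "concat (replicate m (replicate l Box @ [Zero]))"
  let ?U = "blocks l ` {ds. ds \<noteq> [] \<and> ds \<in> lists {Zero, One}}"
  assume e: "expandable (counter l) ?u x"
  show "l + 1 \<le> length x"
  proof (rule ccontr)
    assume "\<not> l + 1 \<le> length x"
    then have x: "length x \<le> l" by simp
    have "?u = blocks l (replicate m Zero)" by (simp add: blocks_def)
    \<comment> \<open>Here \<open>m \<ge> 1\<close> supplies the nonempty digit list.\<close>
    then have u: "?u \<in> ?U" using assms(2) by auto
    have "act (counter l) s v \<in> ?U \<and> act (counter l) s (v @ x) = act (counter l) s v @ x"
      if s: "s \<in> states (counter l)" and v: "v \<in> ?U" for s v
    proof -
      from v obtain ds where ds: "ds \<noteq> []" "ds \<in> lists {Zero, One}" "v = blocks l ds"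
        by blast
      obtain ds' where ds': "ds' \<noteq> []" "ds' \<in> lists {Zero, One}"
        and act: "\<And>x. length x \<le> l \<Longrightarrow> act (counter l) s (v @ x) = blocks l ds' @ x"
        using act_blocks[OF assms(1) ds(1,2) s] ds(3) by blast
      \<comment> \<open>The empty extension identifies \<open>blocks l ds'\<close> as the image of
        \<open>v\<close> itself.\<close>
      have "act (counter l) s v = blocks l ds'" using act[of "[]"] by simp
      then show ?thesis using ds' act[OF x] by simp
    qed
    then have "orbit (counter l) (?u @ x) = (\<lambda>v. v @ x) ` orbit (counter l) ?u"
      by (intro orbit_append[OF u]) blast+
    then show False using e not_expandable_if_orbit_append by blast
  qed
qed

end
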